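(* Let $p$ be a prime, $\lambda$ a partition, and let $J\subset I\subset P_\lambda$ be ideals of $P_\lambda$. Then the subquotient $A_{p,I}/A_{p,J}$ has a unique $G_{p,\lambda}$-orbit which is not contained in $A_{p,I'}/A_{p,J}$ for any ideal $I'$ of $P_\lambda$ with $J\subset I'\subsetneq I$ (the maximal orbit), namely the image of $O_{p,I}$ in $A_{p,I}/A_{p,J}$. In particular, $A_{p,\lambda}$ has a unique $G_{p,\lambda}$-orbit (the one corresponding to the ideal $P_\lambda$) which does not intersect any proper subgroup of $A_{p,\lambda}$ of the form $A_{p,I}$ with $I$ an ideal of $P_\lambda$.
   Context: A partition is a non-increasing sequence $\lambda=(\lambda_1\geq\cdots\geq\lambda_l)$ of positive integers. $A_{p,\lambda}=\mathbf{Z}/p^{\lambda_1}\mathbf{Z}\oplus\cdots\oplus\mathbf{Z}/p^{\lambda_l}\mathbf{Z}$ and $G_{p,\lambda}$ is its automorphism group. Fundamental poset $P$: its elements are the symbols $(p^r,k)$ with integers $0\leq r<k$, where $(p^r,k)$ stands for the orbit of $p^r$ in $\mathbf{Z}/p^k\mathbf{Z}$ under automorphisms of $\mathbf{Z}/p^k\mathbf{Z}$, i.e. the set of elements $p^ru$ with $p\nmid u$. The partial order is: $(p^r,k)\geq(p^s,l)$ if and only if $r\leq s$ and $k-r\geq l-s$ (equivalently, some homomorphism $\mathbf{Z}/p^k\mathbf{Z}\to\mathbf{Z}/p^l\mathbf{Z}$ maps $p^r$ to $p^s$). $P_\lambda$ is the induced subposet consisting of the elements $(p^r,k)$ with $k=\lambda_i$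 for some $i$. An ideal of a poset is a (possibly empty) down-closed subset. For $a=(a_1,\ldots,a_l)\in A_{p,\lambda}$, $I(a)$ is the ideal of $P$ generated by the orbits of the non-zero coordinates $a_i\in\mathbf{Z}/p^{\lambda_i}\mathbf{Z}$ ($a_i=p^ru\neq0$ with $p\nmid u$ contributes $(p^r,\lambda_i)$), and $I_\lambda(a)=I(a)\cap P_\lambda$. For an ideal $I$ of $P_\lambda$: $A_{p,I}=\{a\in A_{p,\lambda}: I_\lambda(a)\subset I\}$, a subgroup of $A_{p,\lambda}$ invariant under $G_{p,\lambda}$; and $O_{p,I}=\{a\in A_{p,\lambda}: I_\lambda(a)=I\}$, which is the $G_{p,\lambda}$-orbit in $A_{p,\lambda}$ corresponding to $I$. For ideals $J\subset I$, $G_{p,\lambda}$ acts on the subquotient $A_{p,I}/A_{p,J}$ through its action on $A_{p,\lambda}$. *)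

theory Defs
  imports
    "HOL-Algebra.Group_Action"
    "HOL-Algebra.Product_Groups"
    "HOL-Computational_Algebra.Primes"
begin

definition is_partition :: "nat list \<Rightarrow> bool" where
  "is_partition ls \<longleftrightarrow> sorted_wrt (\<ge>) ls \<and> (\<forall>k \<in> set ls. 0 < k)"

definition A_group :: "nat \<Rightarrow> nat list \<Rightarrow> (nat \<Rightarrow> int) monoid" where
  "A_group p ls = product_group {..<length ls} (\<lambda>i. integer_mod_group (p ^ (ls ! i)))"

abbreviation G_group :: "nat \<Rightarrow> nat list \<Rightarrow> ((nat \<Rightarrow> int) \<Rightarrow> nat \<Rightarrow> int) monoid" where
  "G_group p ls \<equiv> AutoGroup (A_group p ls)"

text \<open>The symbol \<open>(p\<^sup>r, k)\<close> of the fundamental poset is encoded as the pair \<open>(r, k)\<close>.\<close>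

definition fund_poset :: "(nat \<times> nat) set" where
  "fund_poset = {(r, k). r < k}"

definition fund_le :: "nat \<times> nat \<Rightarrow> nat \<times> nat \<Rightarrow> bool" where
  "fund_le = (\<lambda>(s, l) (r, k). r \<le> s \<and> l - s \<le> k - r)"

definition P_part :: "nat list \<Rightarrow> (nat \<times> nat) set" where
  "P_part ls = {(r, k) \<in> fund_poset. k \<in> set ls}"

definition poset_ideal :: "(nat \<times> nat) set \<Rightarrow> (nat \<times> nat) set \<Rightarrow> bool" where
  "poset_ideal Q I \<longleftrightarrow> I \<subseteq> Q \<and> (\<forall>x \<in> I. \<forall>y \<in> Q. fund_le y x \<longrightarrow> y \<in> I)"

definition generated_ideal :: "(nat \<times> nat) set \<Rightarrow> (nat \<times> nat) set" where
  "generated_ideal S = {y \<in> fund_poset. \<exists>x \<in> S. fund_le y x}"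

text \<open>A coordinate \<open>a i\<close> is represented by an integer in \<open>{0..<p ^ (ls ! i)}\<close>; if it is non-zero,
  then \<open>a i = p\<^sup>r * u\<close> with \<open>u\<close> prime to \<open>p\<close> exactly for \<open>r = multiplicity p (a i)\<close>.\<close>

definition elem_ideal :: "nat \<Rightarrow> nat list \<Rightarrow> (nat \<Rightarrow> int) \<Rightarrow> (nat \<times> nat) set" where
  "elem_ideal p ls a =
     generated_ideal {(multiplicity (int p) (a i), ls ! i) | i. i < length ls \<and> a i \<noteq> 0}"

definition elem_ideal_part :: "nat \<Rightarrow> nat list \<Rightarrow> (nat \<Rightarrow> int) \<Rightarrow> (nat \<times> nat) set" where
  "elem_ideal_part p ls a = elem_ideal p ls a \<inter> P_part ls"

definition A_ideal :: "nat \<Rightarrow> nat list \<Rightarrow> (nat \<times> nat) set \<Rightarrow> (nat \<Rightarrow> int) set" where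
  "A_ideal p ls I = {a \<in> carrier (A_group p ls). elem_ideal_part p ls a \<subseteq> I}"

definition O_ideal :: "nat \<Rightarrow> nat list \<Rightarrow> (nat \<times> nat) set \<Rightarrow> (nat \<Rightarrow> int) set" where
  "O_ideal p ls I = {a \<in> carrier (A_group p ls). elem_ideal_part p ls a = I}"

definition subquotient ::
    "nat \<Rightarrow> nat list \<Rightarrow> (nat \<times> nat) set \<Rightarrow> (nat \<times> nat) set \<Rightarrow> (nat \<Rightarrow> int) set monoid" where
  "subquotient p ls I J = (A_group p ls)\<lparr>carrier := A_ideal p ls I\<rparr> Mod A_ideal p ls J"

definition subquotient_action ::
    "nat \<Rightarrow> nat list \<Rightarrow> (nat \<times> nat) set \<Rightarrow> (nat \<times> nat) set \<Rightarrow>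
     ((nat \<Rightarrow> int) \<Rightarrow> nat \<Rightarrow> int) \<Rightarrow> (nat \<Rightarrow> int) set \<Rightarrow> (nat \<Rightarrow> int) set" where
  "subquotient_action p ls I J g = (\<lambda>U \<in> carrier (subquotient p ls I J). g ` U)"

definition maximal_orbit ::
    "nat \<Rightarrow> nat list \<Rightarrow> (nat \<times> nat) set \<Rightarrow> (nat \<times> nat) set \<Rightarrow> (nat \<Rightarrow> int) set set \<Rightarrow> bool" where
  "maximal_orbit p ls I J T \<longleftrightarrow>
     T \<in> orbits (G_group p ls) (carrier (subquotient p ls I J)) (subquotient_action p ls I J) \<and>
     (\<forall>I'. poset_ideal (P_part ls) I' \<and> J \<subseteq> I' \<and> I' \<subset> I \<longrightarrow>
        \<not> T \<subseteq> carrier (subquotient p ls I' J))"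

definition O_image ::
    "nat \<Rightarrow> nat list \<Rightarrow> (nat \<times> nat) set \<Rightarrow> (nat \<times> nat) set \<Rightarrow> (nat \<Rightarrow> int) set set" where
  "O_image p ls I J = (\<lambda>a. A_ideal p ls J #>\<^bsub>A_group p ls\<^esub> a) ` O_ideal p ls I"

text \<open>Elements of \<open>AutoGroup\<close> are functions, so they act on \<open>A_group p ls\<close> via the identity map.\<close>

definition generic_orbit :: "nat \<Rightarrow> nat list \<Rightarrow> (nat \<Rightarrow> int) set \<Rightarrow> bool" where
  "generic_orbit p ls T \<longleftrightarrow>
     T \<in> orbits (G_group p ls) (carrier (A_group p ls)) (\<lambda>g. g) \<and>
     (\<forall>I. poset_ideal (P_part ls) I \<and> A_ideal p ls I \<subset> carrier (A_group p ls) \<longrightarrow>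
        T \<inter> A_ideal p ls I = {})"

end

(* Automorphisms preserve the ideal of an element because every endomorphism maps each A_I into
   itself. Conversely O_I is a single orbit: if (p^r, k) in I lies below the orbit of the coordinate
   a_j, then adding a multiple of a_j to a coordinate with lambda_i = k is an automorphism that can
   make this coordinate equal to p^r; doing this for all i in turn brings a to a normal form that
   depends only on I.
   If a has ideal K, its orbit in A_I / A_J lies in A_{K Un J} / A_J, so it can only be maximal if
   K Un J = I. In that case the coset of a modulo A_J meets O_I. *)

theory Submission
  imports Defs
begin

section \<open>Poset ideals and their levels\<close>

lemma poset_ideal_Un:
  "poset_ideal P I \<Longrightarrow> poset_ideal P J \<Longrightarrow> poset_ideal P (I \<union> J)"
  unfolding poset_ideal_def by blast

lemma mem_elem_ideal_part_iff:
  "y \<in> elem_ideal_part p ls a \<longleftrightarrow> y \<in> P_part ls \<and>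
     (\<exists>i<length ls. a i \<noteq> 0 \<and> fund_le y (multiplicity (int p) (a i), ls ! i))"
  unfolding elem_ideal_part_def elem_ideal_def generated_ideal_def P_part_def by auto

lemma fund_le_trans: "fund_le x y \<Longrightarrow> fund_le y z \<Longrightarrow> fund_le x z"
  by (auto simp: fund_le_def)

lemma poset_ideal_elem_ideal_part: "poset_ideal (P_part ls) (elem_ideal_part p ls a)"
  by (auto simp: poset_ideal_def mem_elem_ideal_part_iff) (meson fund_le_trans)

lemma mem_O_ideal_elem_ideal_part:
  "a \<in> carrier (A_group p ls) \<Longrightarrow> a \<in> O_ideal p ls (elem_ideal_part p ls a)"
  by (simp add: O_ideal_def)

lemma O_ideal_subset_A_ideal: "O_ideal p ls I \<subseteq> A_ideal p ls I"
  by (auto simp: O_ideal_def A_ideal_def)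

lemma A_ideal_mono: "I \<subseteq> J \<Longrightarrow> A_ideal p ls I \<subseteq> A_ideal p ls J"
  by (auto simp: A_ideal_def)

text \<open>Since \<open>(r + 1, k)\<close> lies below \<open>(r, k)\<close>, the part of an ideal over a fixed \<open>k\<close> is
  \<open>{(r, k) | level I k \<le> r < k}\<close>; the value is \<open>k\<close> if this part is empty.\<close>

definition level :: "(nat \<times> nat) set \<Rightarrow> nat \<Rightarrow> nat" where
  "level I k = (LEAST r. (r, k) \<in> I \<or> r = k)"

lemma level_le: "level I k \<le> k"
  unfolding level_def by (rule Least_le) simp

lemma level_mem: "level I k < k \<Longrightarrow> (level I k, k) \<in> I"
  using LeastI[of "\<lambda>r. (r, k) \<in> I \<or> r = k" k] unfolding level_def by auto

lemma mem_ideal_iff_level_le: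
  assumes "poset_ideal (P_part ls) I" "k \<in> set ls" "r < k"
  shows "(r, k) \<in> I \<longleftrightarrow> level I k \<le> r"
proof
  assume "(r, k) \<in> I"
  then show "level I k \<le> r" unfolding level_def by (intro Least_le) simp
next
  assume *: "level I k \<le> r"
  then have "(level I k, k) \<in> I" using assms(3) by (intro level_mem) simp
  moreover have "(r, k) \<in> P_part ls" using assms by (simp add: P_part_def fund_poset_def)
  moreover have "fund_le (r, k) (level I k, k)" using * by (simp add: fund_le_def)
  ultimately show "(r, k) \<in> I" using assms(1) unfolding poset_ideal_def by blast
qed

section \<open>Coordinates in the group \<open>A\<close>\<close>

locale prime_type =
  fixes p :: nat and ls :: "nat list"
  assumes prime_p: "Factorial_Ring.prime p"
begin

abbreviation A where "A \<equiv> A_group p ls"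

lemma p_pos: "0 < p"
  using prime_p by (simp add: prime_gt_0_nat)

lemma prime_int_p: "Factorial_Ring.prime (int p)"
  using prime_p by simp

lemma not_unit_p: "\<not> is_unit (int p)"
  using prime_int_p not_prime_unit by blast

lemma mem_carrier_A:
  "a \<in> carrier A \<longleftrightarrow> a \<in> extensional {..<length ls} \<and>
     (\<forall>i<length ls. 0 \<le> a i \<and> a i < int p ^ (ls ! i))"
proof -
  have "carrier (integer_mod_group (p ^ k)) = {0..<int p ^ k}" for k
    using p_pos by (simp add: carrier_integer_mod_group)
  then show ?thesis by (auto simp: A_group_def PiE_iff)
qed

lemma mult_A: "x \<otimes>\<^bsub>A\<^esub> y = (\<lambda>i\<in>{..<length ls}. (x i + y i) mod int p ^ (ls ! i))"
  by (simp add: A_group_def)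

lemma one_A: "\<one>\<^bsub>A\<^esub> = (\<lambda>i\<in>{..<length ls}. 0)"
  by (simp add: A_group_def)

lemma group_A: "group A"
  by (simp add: A_group_def)

lemma inv_A:
  assumes "x \<in> carrier A"
  shows "inv\<^bsub>A\<^esub> x = (\<lambda>i\<in>{..<length ls}. (- x i) mod int p ^ (ls ! i))"
proof -
  have "x \<in> (\<Pi>\<^sub>E i\<in>{..<length ls}. carrier (integer_mod_group (p ^ (ls ! i))))"
    using assms by (simp add: A_group_def)
  then show ?thesis
    unfolding A_group_def by (subst inv_product_group) (auto simp: PiE_iff intro!: restrict_ext)
qed

lemma finite_carrier_A: "finite (carrier A)"
  unfolding A_group_def carrier_product_group
  using p_pos by (intro finite_PiE) (simp_all add: carrier_integer_mod_group)

lemma A_ext: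
  assumes "x \<in> carrier A" "y \<in> carrier A" "\<And>i. i < length ls \<Longrightarrow> x i = y i"
  shows "x = y"
  using assms by (intro extensionalityI[of x "{..<length ls}" y]) (simp_all add: mem_carrier_A)

lemma restrict_mod_mem_A: "(\<lambda>i\<in>{..<length ls}. f i mod int p ^ (ls ! i)) \<in> carrier A"
  using p_pos by (auto simp: mem_carrier_A)

lemma mod_q_mem:
  "a \<in> carrier A \<Longrightarrow> i < length ls \<Longrightarrow> a i mod int p ^ (ls ! i) = a i"
  by (simp add: mem_carrier_A)

lemma pow_A:
  assumes "x \<in> carrier A" "i < length ls"
  shows "(x [^]\<^bsub>A\<^esub> (n::nat)) i = (int n * x i) mod int p ^ (ls ! i)"
proof (induction n)
  case 0
  then show ?case using assms group_A by (simp add: one_A)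
next
  case (Suc n)
  then show ?case using assms
    by (simp add: mult_A mod_simps algebra_simps)
qed

text \<open>Representatives lie below \<open>p ^ (ls ! i)\<close>, so a non-zero one is not
  divisible by it. Hence the symbol of a non-zero coordinate is a point of the poset.\<close>

lemma multiplicity_less:
  assumes "a \<in> carrier A" "i < length ls" "a i \<noteq> 0"
  shows "multiplicity (int p) (a i) < ls ! i"
proof (rule multiplicity_lessI[OF assms(3) not_unit_p])
  show "\<not> int p ^ (ls ! i) dvd a i"
    using assms by (metis mem_carrier_A leD zdvd_not_zless dual_order.order_iff_strict)
qed

lemma multiplicity_mem_elem_ideal_part:
  assumes "a \<in> carrier A" "i < length ls" "a i \<noteq> 0"
  shows "(multiplicity (int p) (a i), ls ! i) \<in> elem_ideal_part p ls a"
  using assms multiplicity_less[OF assms]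
  by (auto simp: mem_elem_ideal_part_iff P_part_def fund_poset_def fund_le_def)

section \<open>The subgroups \<open>A_ideal p ls I\<close> and their invariance under
  endomorphisms\<close>

lemma mem_ideal_iff_dvd:
  assumes "poset_ideal (P_part ls) I" "a \<in> carrier A" "i < length ls" "a i \<noteq> 0"
  shows "(multiplicity (int p) (a i), ls ! i) \<in> I \<longleftrightarrow> int p ^ level I (ls ! i) dvd a i"
  using mem_ideal_iff_level_le[OF assms(1), of "ls ! i"] multiplicity_less[OF assms(2-4)]
    power_dvd_iff_le_multiplicity[OF assms(4) not_unit_p] assms(3) by simp

text \<open>An ideal contains \<open>elem_ideal_part p ls a\<close> as soon as it contains its
  generators, so the condition splits over the coordinates. This exhibits
  \<open>A_ideal p ls I\<close> as a product of subgroups of the cyclic factors; a level equal to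
  \<open>ls ! i\<close> forces the coordinate to be 0.\<close>

lemma mem_A_ideal_iff:
  assumes I: "poset_ideal (P_part ls) I"
  shows "a \<in> A_ideal p ls I \<longleftrightarrow>
    a \<in> carrier A \<and> (\<forall>i<length ls. int p ^ level I (ls ! i) dvd a i)"
proof (cases "a \<in> carrier A")
  case True
  have "elem_ideal_part p ls a \<subseteq> I \<longleftrightarrow>
      (\<forall>i<length ls. a i \<noteq> 0 \<longrightarrow> (multiplicity (int p) (a i), ls ! i) \<in> I)"
  proof
    assume "elem_ideal_part p ls a \<subseteq> I"
    then show "\<forall>i<length ls. a i \<noteq> 0 \<longrightarrow> (multiplicity (int p) (a i), ls ! i) \<in> I"
      using multiplicity_mem_elem_ideal_part[OF True] by blast
  next
    assume "\<forall>i<length ls. a i \<noteq> 0 \<longrightarrow> (multiplicity (int p) (a i), ls ! i) \<in> I"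
    then show "elem_ideal_part p ls a \<subseteq> I"
      using I unfolding poset_ideal_def mem_elem_ideal_part_iff subset_iff by blast
  qed
  then show ?thesis
    using True mem_ideal_iff_dvd[OF I True] by (auto simp: A_ideal_def)
qed (simp add: A_ideal_def)

lemma dvd_mod_q:
  "r \<le> k \<Longrightarrow> int p ^ r dvd x \<Longrightarrow> int p ^ r dvd x mod int p ^ k"
  by (simp add: dvd_mod le_imp_power_dvd)

lemma subgroup_A_ideal:
  assumes I: "poset_ideal (P_part ls) I"
  shows "subgroup (A_ideal p ls I) A"
proof
  interpret group A by (rule group_A)
  show "A_ideal p ls I \<subseteq> carrier A" by (auto simp: A_ideal_def)
  show "\<one>\<^bsub>A\<^esub> \<in> A_ideal p ls I"
    using one_closed by (auto simp: mem_A_ideal_iff[OF I] one_A)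
  show "x \<otimes>\<^bsub>A\<^esub> y \<in> A_ideal p ls I" if "x \<in> A_ideal p ls I" "y \<in> A_ideal p ls I" for x y
    using that m_closed[of x y]
    by (auto simp: mem_A_ideal_iff[OF I] mult_A intro!: dvd_mod_q level_le)
  show "inv\<^bsub>A\<^esub> x \<in> A_ideal p ls I" if "x \<in> A_ideal p ls I" for x
    using that inv_closed[of x]
    by (auto simp: mem_A_ideal_iff[OF I] inv_A intro!: dvd_mod_q level_le)
qed

text \<open>An element \<open>x\<close> supported in a coordinate with \<open>k = ls ! n\<close> and divisible by \<open>p\<^sup>r\<close>
  lies in \<open>p\<^sup>rA\<close> and is killed by \<open>p\<^sup>k\<^sup>-\<^sup>r\<close>; both properties pass to \<open>f x\<close>, and
  coordinatewise they say that the orbits of \<open>f x\<close> lie below \<open>(p\<^sup>r, k)\<close>.\<close>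

lemma hom_single_mem_A_ideal:
  assumes I: "poset_ideal (P_part ls) I" and f: "f \<in> hom A A"
    and x: "x \<in> A_ideal p ls I" and n: "n < length ls"
    and supp: "\<And>i. i < length ls \<Longrightarrow> i \<noteq> n \<Longrightarrow> x i = 0"
  shows "f x \<in> A_ideal p ls I"
proof -
  interpret group A by (rule group_A)
  define r where "r = level I (ls ! n)"
  have rle: "r \<le> ls ! n" by (simp add: r_def level_le)
  have xc: "x \<in> carrier A" and xd: "int p ^ r dvd x n"
    using x n by (auto simp: mem_A_ideal_iff[OF I] r_def)
  then obtain w where w: "x n = int p ^ r * w" by (auto elim: dvdE)
  define y where "y = (\<lambda>i\<in>{..<length ls}. (if i = n then w else 0) mod int p ^ (ls ! i))"
  have yc: "y \<in> carrier A" unfolding y_def by (rule restrict_mod_mem_A)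
  have xy: "x = y [^]\<^bsub>A\<^esub> (p ^ r)"
  proof (rule A_ext[OF xc nat_pow_closed[OF yc]])
    fix i assume i: "i < length ls"
    show "x i = (y [^]\<^bsub>A\<^esub> (p ^ r)) i"
      using i w supp[OF i] mod_q_mem[OF xc i]
      by (simp add: pow_A[OF yc i]) (auto simp: y_def mod_mult_right_eq)
  qed
  have x1: "x [^]\<^bsub>A\<^esub> (p ^ (ls ! n - r)) = \<one>\<^bsub>A\<^esub>"
  proof (rule A_ext[OF nat_pow_closed[OF xc] one_closed])
    fix i assume i: "i < length ls"
    have "int p ^ (ls ! n - r) * (int p ^ r * w) = int p ^ (ls ! n) * w"
      using rle by (simp add: power_add[symmetric] mult.assoc[symmetric])
    then have "(int p ^ (ls ! n - r) * x n) mod int p ^ (ls ! n) = 0"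
      unfolding w by (simp only: mod_mult_self1_is_0)
    then show "(x [^]\<^bsub>A\<^esub> (p ^ (ls ! n - r))) i = \<one>\<^bsub>A\<^esub> i"
      using i n supp[OF i] by (cases "i = n") (simp_all add: pow_A[OF xc] one_A)
  qed
  have fx: "f x \<in> carrier A" and fy: "f y \<in> carrier A"
    using f xc yc by (auto simp: hom_def)
  have "f x = f y [^]\<^bsub>A\<^esub> (p ^ r)"
    unfolding xy by (rule hom_nat_pow[OF f yc group_A group_A])
  then have fxy: "f x j = (int p ^ r * f y j) mod int p ^ (ls ! j)" if "j < length ls" for j
    using pow_A[OF fy that] by simp
  have "f x [^]\<^bsub>A\<^esub> (p ^ (ls ! n - r)) = \<one>\<^bsub>A\<^esub>"
    using hom_nat_pow[OF f xc group_A group_A] x1 hom_one[OF f group_A group_A] by metis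
  then have fx1: "(int p ^ (ls ! n - r) * f x j) mod int p ^ (ls ! j) = 0"
    if "j < length ls" for j
    using pow_A[OF fx that, of "p ^ (ls ! n - r)"] that by (simp add: one_A)
  have "int p ^ level I (ls ! j) dvd f x j" if j: "j < length ls" for j
  proof (cases "f x j = 0")
    case False
    define v where "v = multiplicity (int p) (f x j)"
    have vlt: "v < ls ! j" unfolding v_def by (rule multiplicity_less[OF fx j False])
    \<comment> \<open>Otherwise \<open>p ^ r\<close> would annihilate the factor of order
      \<open>p ^ (ls ! j)\<close>, and \<open>f x j\<close> would be 0.\<close>
    have "r \<le> ls ! j"
    proof (rule ccontr)
      assume "\<not> r \<le> ls ! j"
      then have "int p ^ (ls ! j) dvd int p ^ r * f y j" by (simp add: le_imp_power_dvd)
      then show False using fxy[OF j] False by simp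
    qed
    then have "int p ^ r dvd f x j" using fxy[OF j] dvd_mod_q by simp
    then have rv: "r \<le> v"
      using power_dvd_iff_le_multiplicity[OF False not_unit_p] by (simp add: v_def)
    have "int p ^ (ls ! j) dvd int p ^ (ls ! n - r) * f x j" using fx1[OF j] by auto
    then have "ls ! j \<le> multiplicity (int p) (int p ^ (ls ! n - r) * f x j)"
      using power_dvd_iff_le_multiplicity[of "int p ^ (ls ! n - r) * f x j"] False p_pos not_unit_p
      by simp
    also have "\<dots> = (ls ! n - r) + v"
      using prime_int_p False p_pos not_unit_p unfolding v_def
      by (subst prime_elem_multiplicity_mult_distrib) (auto simp: multiplicity_same_power)
    finally have le: "ls ! j - v \<le> ls ! n - r" by simp
    \<comment> \<open>Since \<open>v < ls ! j\<close>, the level \<open>r\<close> is not the default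
      value \<open>ls ! n\<close>, so it comes from an actual element of \<open>I\<close>.\<close>
    then have "r < ls ! n" using vlt by simp
    then have "(r, ls ! n) \<in> I" unfolding r_def by (rule level_mem)
    moreover have "fund_le (v, ls ! j) (r, ls ! n)" using rv le by (simp add: fund_le_def)
    moreover have "(v, ls ! j) \<in> P_part ls" using vlt j by (simp add: P_part_def fund_poset_def)
    ultimately have "(v, ls ! j) \<in> I" using I unfolding poset_ideal_def by blast
    then show ?thesis using mem_ideal_iff_dvd[OF I fx j False] by (simp add: v_def)
  qed simp
  then show ?thesis using fx by (simp add: mem_A_ideal_iff[OF I])
qed

text \<open>Membership in \<open>A_ideal p ls I\<close> is coordinatewise, so \<open>a\<close> is a
  sum of elements of this subgroup with a single coordinate each, and additivity of \<open>f\<close>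
  reduces the claim to those.\<close>

lemma hom_mem_A_ideal:
  assumes I: "poset_ideal (P_part ls) I" and f: "f \<in> hom A A" and a: "a \<in> A_ideal p ls I"
  shows "f a \<in> A_ideal p ls I"
proof -
  interpret group A by (rule group_A)
  interpret S: subgroup "A_ideal p ls I" A by (rule subgroup_A_ideal[OF I])
  \<comment> \<open>Here \<open>n\<close> bounds the support of \<open>a\<close>. The induction step
    splits off coordinate \<open>n\<close> as \<open>c\<close> and leaves \<open>b\<close>, which is
    supported below \<open>n\<close>.\<close>
  have "f a \<in> A_ideal p ls I"
    if "n \<le> length ls" "a \<in> A_ideal p ls I" "\<And>i. i < length ls \<Longrightarrow> n \<le> i \<Longrightarrow> a i = 0" for n a
    using that
  proof (induction n arbitrary: a)
    case 0
    have "a = \<one>\<^bsub>A\<^esub>"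
      by (rule A_ext[OF _ one_closed]) (use 0 S.subset in \<open>auto simp: one_A\<close>)
    then show ?case using hom_one[OF f group_A group_A] S.one_closed by simp
  next
    case (Suc n)
    have ac: "a \<in> carrier A" and ad: "\<And>i. i < length ls \<Longrightarrow> int p ^ level I (ls ! i) dvd a i"
      using Suc.prems by (auto simp: mem_A_ideal_iff[OF I])
    define b where "b = (\<lambda>i\<in>{..<length ls}. if i = n then 0 else a i)"
    define c where "c = (\<lambda>i\<in>{..<length ls}. if i = n then a i else 0)"
    have b: "b \<in> A_ideal p ls I" and c: "c \<in> A_ideal p ls I"
      using ac ad p_pos unfolding mem_A_ideal_iff[OF I] mem_carrier_A by (simp_all add: b_def c_def)
    have bc: "b \<in> carrier A" and cc: "c \<in> carrier A" using b c S.subset by blast+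
    have "a = b \<otimes>\<^bsub>A\<^esub> c"
      by (rule A_ext[OF ac m_closed[OF bc cc]])
        (simp add: mult_A b_def c_def mod_q_mem[OF ac])
    then have "f a = f b \<otimes>\<^bsub>A\<^esub> f c"
      using hom_mult[OF f bc cc] by simp
    moreover have "f b \<in> A_ideal p ls I"
      by (rule Suc.IH[OF _ b]) (use Suc.prems in \<open>auto simp: b_def\<close>)
    moreover have "f c \<in> A_ideal p ls I"
      by (rule hom_single_mem_A_ideal[OF I f c, of n]) (use Suc.prems in \<open>auto simp: c_def\<close>)
    ultimately show ?case using S.m_closed by simp
  qed
  then show ?thesis using a by (meson order_refl leD)
qed

section \<open>Automorphisms and the ideal of an element\<close>

lemma auto_closed: "g \<in> auto A \<Longrightarrow> x \<in> carrier A \<Longrightarrow> g x \<in> carrier A"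
  by (auto simp: auto_def hom_def)

lemma auto_comp:
  assumes "g \<in> auto A" "h \<in> auto A"
  shows "compose (carrier A) g h \<in> auto A"
  using assms group.hom_compose[OF group_A] compose_Bij
  by (auto simp: auto_def intro: Bij_imp_funcset)

lemma auto_inverse:
  assumes "g \<in> auto A"
  obtains h where "h \<in> auto A" "\<And>x. x \<in> carrier A \<Longrightarrow> h (g x) = x"
proof
  let ?h = "restrict (inv_into (carrier A) g) (carrier A)"
  have g: "g \<in> hom A A" "g \<in> Bij (carrier A)" using assms by (auto simp: auto_def)
  show "?h \<in> auto A"
    using group.restrict_inv_into_hom[OF group_A g] restrict_inv_into_Bij[OF g(2)]
    by (simp add: auto_def)
  show "?h (g x) = x" if "x \<in> carrier A" for x
    using that g by (auto simp: Bij_def bij_betw_def)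
qed

text \<open>Invariance of \<open>A_ideal p ls I\<close>, taken for the ideal of the element itself,
  gives one inclusion; the inverse automorphism gives the other.\<close>

lemma elem_ideal_part_auto:
  assumes g: "g \<in> auto A" and a: "a \<in> carrier A"
  shows "elem_ideal_part p ls (g a) = elem_ideal_part p ls a"
proof -
  have sub: "elem_ideal_part p ls (h b) \<subseteq> elem_ideal_part p ls b"
    if "h \<in> auto A" "b \<in> carrier A" for h b
  proof -
    have "h b \<in> A_ideal p ls (elem_ideal_part p ls b)"
      by (rule hom_mem_A_ideal[OF poset_ideal_elem_ideal_part])
        (use that in \<open>auto simp: A_ideal_def auto_def\<close>)
    then show ?thesis by (simp add: A_ideal_def)
  qed
  obtain h where "h \<in> auto A" "h (g a) = a"
    using auto_inverse[OF g] a by metis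
  then show ?thesis
    using sub[OF g a] sub[of h "g a"] auto_closed[OF g a] by auto
qed

section \<open>Normal form and transitivity\<close>

text \<open>The divisibility makes multiplication by \<open>m\<close> a well-defined map from factor
  \<open>j\<close> to factor \<open>i\<close>. For distinct indices the map is a transvection; for
  \<open>i = j\<close> it multiplies coordinate \<open>i\<close> by \<open>1 + m\<close>, a unit
  modulo \<open>p ^ (ls ! i)\<close>.\<close>

lemma shear_mem_auto:
  assumes i: "i < length ls" and j: "j < length ls"
    and dvd: "int p ^ (ls ! i) dvd m * int p ^ (ls ! j)"
    and unit: "i = j \<Longrightarrow> \<not> int p dvd 1 + m"
  shows "(\<lambda>x\<in>carrier A. x(i := (x i + m * x j) mod int p ^ (ls ! i))) \<in> auto A"
proof -
  interpret group A by (rule group_A)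
  let ?q = "\<lambda>k. int p ^ (ls ! k)"
  let ?f = "\<lambda>x\<in>carrier A. x(i := (x i + m * x j) mod ?q i)"
  have cl: "?f x \<in> carrier A" if "x \<in> carrier A" for x
    using that i p_pos by (auto simp: mem_carrier_A extensional_def)
  have scale: "(s + m * (t mod ?q j)) mod ?q i = (s + m * t) mod ?q i" for s t
  proof -
    have "(s + m * t) - (s + m * (t mod ?q j)) = m * ?q j * (t div ?q j)"
      by (simp add: minus_mod_eq_mult_div[symmetric] algebra_simps)
    then have "?q i dvd (s + m * t) - (s + m * (t mod ?q j))" using dvd by simp
    then show ?thesis by (metis mod_eq_dvd_iff)
  qed
  have hom: "?f \<in> hom A A"
  proof (rule homI)
    show "?f x \<in> carrier A" if "x \<in> carrier A" for x using cl that .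
    fix x y assume x: "x \<in> carrier A" and y: "y \<in> carrier A"
    show "?f (x \<otimes>\<^bsub>A\<^esub> y) = ?f x \<otimes>\<^bsub>A\<^esub> ?f y"
    proof (rule A_ext[OF cl[OF m_closed[OF x y]] m_closed[OF cl[OF x] cl[OF y]]])
      fix k assume k: "k < length ls"
      show "?f (x \<otimes>\<^bsub>A\<^esub> y) k = (?f x \<otimes>\<^bsub>A\<^esub> ?f y) k"
      proof (cases "k = i")
        case True
        have "((x i + y i) mod ?q i + m * ((x j + y j) mod ?q j)) mod ?q i
            = ((x i + y i) mod ?q i + m * (x j + y j)) mod ?q i" by (rule scale)
        also have "\<dots> = ((x i + m * x j) mod ?q i + (y i + m * y j) mod ?q i) mod ?q i"
          unfolding mod_add_eq mod_add_left_eq mod_add_right_eq by (simp add: algebra_simps)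
        finally show ?thesis
          using True i j m_closed[OF x y] x y by (simp add: mult_A)
      next
        case False
        then show ?thesis using k m_closed[OF x y] x y by (simp add: mult_A)
      qed
    qed
  qed
  have inj: "inj_on ?f (carrier A)"
  proof (rule inj_onI)
    fix x y assume x: "x \<in> carrier A" and y: "y \<in> carrier A" and eq: "?f x = ?f y"
    have eq': "(?f x) k = (?f y) k" for k using eq by simp
    have off: "x k = y k" if "k \<noteq> i" for k using eq'[of k] that x y by simp
    have "(x i + m * x j) mod ?q i = (y i + m * y j) mod ?q i" using eq'[of i] x y by simp
    then have d: "?q i dvd (x i + m * x j) - (y i + m * y j)" by (simp add: mod_eq_dvd_iff)
    \<comment> \<open>For \<open>i = j\<close> the factor \<open>1 + m\<close> is cancelled;
      otherwise \<open>x j = y j\<close> and the added terms cancel.\<close>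
    have "?q i dvd x i - y i"
    proof (cases "i = j")
      case True
      have "coprime (?q i) (1 + m)"
        using unit[OF True] prime_int_p by (simp add: prime_imp_coprime coprime_power_left_iff)
      moreover have "(x i + m * x j) - (y i + m * y j) = (1 + m) * (x i - y i)"
        using True by (simp add: algebra_simps)
      ultimately show ?thesis using d by (simp add: coprime_dvd_mult_right_iff)
    next
      case False
      then show ?thesis using d off[of j] by simp
    qed
    then have "x i = y i"
      using mod_q_mem[OF x i] mod_q_mem[OF y i] by (metis mod_eq_dvd_iff)
    then show "x = y" using off by fastforce
  qed
  \<comment> \<open>Surjectivity comes from finiteness of \<open>A\<close>.\<close>
  have "?f ` carrier A = carrier A"
    by (rule endo_inj_surj[OF finite_carrier_A _ inj]) (use cl in blast)
  then show ?thesis using hom inj by (auto simp: auto_def Bij_def bij_betw_def)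
qed

lemma auto_normalise_coordinate:
  assumes I: "poset_ideal (P_part ls) I" and a: "a \<in> O_ideal p ls I" and i: "i < length ls"
  shows "\<exists>g\<in>auto A. g a = a(i := int p ^ level I (ls ! i) mod int p ^ (ls ! i))"
proof -
  interpret group A by (rule group_A)
  define r where "r = level I (ls ! i)"
  have ac: "a \<in> carrier A" and aI: "elem_ideal_part p ls a = I" using a by (auto simp: O_ideal_def)
  have "a \<in> A_ideal p ls I" using a O_ideal_subset_A_ideal by blast
  then have ad: "int p ^ r dvd a i" using i by (simp add: mem_A_ideal_iff[OF I] r_def)
  show ?thesis
  proof (cases "r = ls ! i")
    case True
    \<comment> \<open>This is the default value of \<open>level\<close>: the old and the new
      coordinate are both 0, so the identity suffices.\<close>
    then have "a i mod int p ^ r = 0" using ad by simp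
    then have "a i = 0" using mod_q_mem[OF ac i] True by simp
    then have "(\<lambda>x\<in>carrier A. x) a = a(i := int p ^ r mod int p ^ (ls ! i))"
      using True ac by (auto simp: fun_eq_iff)
    then show ?thesis using id_in_auto unfolding r_def by blast
  next
    case False
    then have rlt: "r < ls ! i" using level_le[of I "ls ! i"] by (simp add: r_def)
    \<comment> \<open>Equality of the ideal of \<open>a\<close> with \<open>I\<close>, not just
      inclusion, supplies a coordinate \<open>a j\<close> above \<open>(r, ls ! i)\<close>.\<close>
    then have "(r, ls ! i) \<in> elem_ideal_part p ls a"
      using aI level_mem[of I "ls ! i"] by (simp add: r_def)
    then obtain j where j: "j < length ls" "a j \<noteq> 0"
      and le: "fund_le (r, ls ! i) (multiplicity (int p) (a j), ls ! j)"
      unfolding mem_elem_ideal_part_iff by blast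
    define v where "v = multiplicity (int p) (a j)"
    have vr: "v \<le> r" and le': "ls ! i - r \<le> ls ! j - v"
      using le by (auto simp: fund_le_def v_def)
    obtain w where w: "a j = int p ^ v * w" "\<not> int p dvd w"
      unfolding v_def by (rule multiplicity_decompose'[OF j(2) not_unit_p])
    obtain z where z: "a i = int p ^ r * z" using ad by (auto elim: dvdE)
    have "coprime (int p ^ (ls ! i)) w"
      using w(2) prime_int_p by (simp add: prime_imp_coprime coprime_power_left_iff)
    \<comment> \<open>Bezout makes \<open>u\<close> an inverse of \<open>w\<close> modulo
      \<open>p ^ (ls ! i)\<close>.\<close>
    then obtain t u where tu: "t * int p ^ (ls ! i) + u * w = 1"
      using bezout_int[of "int p ^ (ls ! i)" w] by auto
    \<comment> \<open>Chosen so that, modulo \<open>p ^ (ls ! i)\<close>, \<open>m * a j\<close> is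
      \<open>p ^ r * (1 - z)\<close>, the difference between the target \<open>p ^ r\<close> and
      \<open>a i\<close>.\<close>
    define m where "m = int p ^ (r - v) * ((1 - z) * u)"
    have "a i + m * a j = int p ^ r * z + (int p ^ (r - v) * int p ^ v) * ((1 - z) * (u * w))"
      by (simp add: z w m_def algebra_simps)
    also have "int p ^ (r - v) * int p ^ v = int p ^ r" using vr by (simp flip: power_add)
    also have "u * w = 1 - t * int p ^ (ls ! i)" using tu by simp
    finally have "a i + m * a j = int p ^ r + int p ^ (ls ! i) * (int p ^ r * (z - 1) * t)"
      by (simp add: algebra_simps)
    then have eq: "(a i + m * a j) mod int p ^ (ls ! i) = int p ^ r mod int p ^ (ls ! i)"
      by (metis mod_mult_self2)
    \<comment> \<open>The second inequality in \<open>fund_le\<close> is what makes the shear by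
      \<open>m\<close> well defined.\<close>
    have "ls ! i \<le> (r - v) + ls ! j"
      using vr le' rlt multiplicity_less[OF ac j] by (simp add: v_def)
    then have "int p ^ (ls ! i) dvd int p ^ (r - v) * int p ^ (ls ! j)"
      by (simp add: le_imp_power_dvd flip: power_add)
    then have dvd: "int p ^ (ls ! i) dvd m * int p ^ (ls ! j)"
      by (simp add: m_def mult.assoc) (metis dvd_mult mult.assoc mult.commute)
    \<comment> \<open>If \<open>i = j\<close>, divisibility of \<open>a i\<close> by
      \<open>p ^ r\<close> forces \<open>v = r\<close> and \<open>z = w\<close>; then
      \<open>(1 + m) * w\<close> is congruent to 1 modulo \<open>p ^ (ls ! i)\<close>, so
      \<open>1 + m\<close> is a unit.\<close>
    have unit: "\<not> int p dvd 1 + m" if "i = j"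
    proof
      assume "int p dvd 1 + m"
      have "r \<le> v" using ad j that power_dvd_iff_le_multiplicity[OF j(2) not_unit_p]
        by (simp add: v_def)
      then have rv: "r = v" using vr by simp
      then have "z = w" using z w that p_pos by simp
      then have "(1 + m) * w = w + (1 - w) * (u * w)" using rv by (simp add: m_def algebra_simps)
      also have "\<dots> = w + (1 - w) * (1 - t * int p ^ (ls ! i))" using tu by (simp add: eq_diff_eq)
      finally have "1 = (1 + m) * w + int p ^ (ls ! i) * ((1 - w) * t)" by (simp add: algebra_simps)
      moreover have "int p dvd int p ^ (ls ! i)" using rlt by (simp add: dvd_power)
      ultimately have "int p dvd 1" using \<open>int p dvd 1 + m\<close> by (metis dvd_add dvd_mult2)
      then show False using not_unit_p by simp
    qed
    have "(\<lambda>x\<in>carrier A. x(i := (x i + m * x j) mod int p ^ (ls ! i))) \<in> auto A"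
      by (rule shear_mem_auto[OF i j(1) dvd]) (rule unit)
    then show ?thesis using ac eq unfolding r_def by (auto intro: rev_bexI)
  qed
qed

text \<open>The coordinates are treated one after the other. Each automorphism keeps the element in
  \<open>O_ideal p ls I\<close>, so \<open>auto_normalise_coordinate\<close> remains
  applicable.\<close>

lemma auto_normalise:
  assumes I: "poset_ideal (P_part ls) I" and a: "a \<in> O_ideal p ls I"
  shows "\<exists>g\<in>auto A. g a = (\<lambda>i\<in>{..<length ls}. int p ^ level I (ls ! i) mod int p ^ (ls ! i))"
proof -
  interpret group A by (rule group_A)
  let ?c = "\<lambda>n. \<lambda>i\<in>{..<length ls}.
    if i < n then int p ^ level I (ls ! i) mod int p ^ (ls ! i) else a i"
  have ac: "a \<in> carrier A" using a by (auto simp: O_ideal_def)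
  have "\<exists>g\<in>auto A. g a = ?c n" if "n \<le> length ls" for n
    using that
  proof (induction n)
    case 0
    have "?c 0 = a" using ac by (auto simp: mem_carrier_A extensional_def)
    then have "(\<lambda>x\<in>carrier A. x) a = ?c 0" using ac by simp
    then show ?case using id_in_auto by blast
  next
    case (Suc n)
    then obtain g where g: "g \<in> auto A" "g a = ?c n" by (meson Suc_leD)
    have "g a \<in> O_ideal p ls I"
      using elem_ideal_part_auto[OF g(1) ac] auto_closed[OF g(1) ac] a by (simp add: O_ideal_def)
    then obtain h where h: "h \<in> auto A"
      "h (g a) = (g a)(n := int p ^ level I (ls ! n) mod int p ^ (ls ! n))"
      using auto_normalise_coordinate[OF I] Suc.prems by (meson Suc_le_lessD)
    have "(?c n)(n := int p ^ level I (ls ! n) mod int p ^ (ls ! n)) = ?c (Suc n)"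
      using Suc.prems by (auto simp: fun_eq_iff less_Suc_eq)
    then have "compose (carrier A) h g a = ?c (Suc n)"
      using h(2) ac unfolding g(2) by (simp add: compose_def g(2))
    then show ?case using auto_comp[OF h(1) g(1)] by blast
  qed
  from this[of "length ls"] show ?thesis by (auto cong: restrict_cong)
qed

text \<open>Both elements are carried to the same normal form, and one of the two automorphisms is
  inverted.\<close>

lemma auto_transitive_on_O_ideal:
  assumes I: "poset_ideal (P_part ls) I" and a: "a \<in> O_ideal p ls I" and b: "b \<in> O_ideal p ls I"
  shows "\<exists>g\<in>auto A. g a = b"
proof -
  have ac: "a \<in> carrier A" and bc: "b \<in> carrier A" using a b by (auto simp: O_ideal_def)
  obtain g h where g: "g \<in> auto A" and h: "h \<in> auto A" and gh: "g a = h b"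
    using auto_normalise[OF I a] auto_normalise[OF I b] by metis
  obtain k where k: "k \<in> auto A" "k (h b) = b" using auto_inverse[OF h] bc by metis
  have "compose (carrier A) k g a = b" using k gh ac by (simp add: compose_def)
  then show ?thesis using auto_comp[OF k(1) g] by blast
qed

lemma auto_image_eq_O_ideal:
  assumes I: "poset_ideal (P_part ls) I" and a: "a \<in> O_ideal p ls I"
  shows "(\<lambda>g. g a) ` auto A = O_ideal p ls I"
proof
  have ac: "a \<in> carrier A" using a by (auto simp: O_ideal_def)
  show "(\<lambda>g. g a) ` auto A \<subseteq> O_ideal p ls I"
    using elem_ideal_part_auto[OF _ ac] auto_closed[OF _ ac] a by (auto simp: O_ideal_def)
  show "O_ideal p ls I \<subseteq> (\<lambda>g. g a) ` auto A"
    using auto_transitive_on_O_ideal[OF I a] by blast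
qed

section \<open>Translation by elements of \<open>A_ideal p ls J\<close>\<close>

text \<open>Every coordinate of \<open>a\<close> whose orbit lies in \<open>J\<close> is replaced by the largest one allowed
  by \<open>J\<close>.\<close>

lemma translate_elem_ideal_part:
  assumes J: "poset_ideal (P_part ls) J" and a: "a \<in> carrier A"
  shows "\<exists>b\<in>A_ideal p ls J. elem_ideal_part p ls (b \<otimes>\<^bsub>A\<^esub> a) = elem_ideal_part p ls a \<union> J"
proof -
  interpret group A by (rule group_A)
  let ?q = "\<lambda>k. int p ^ (ls ! k)" and ?l = "\<lambda>k. int p ^ level J (ls ! k)"
  let ?K = "elem_ideal_part p ls a"
  define b where "b = (\<lambda>i\<in>{..<length ls}. (if ?l i dvd a i then ?l i - a i else 0) mod ?q i)"
  have bc: "b \<in> carrier A" unfolding b_def by (rule restrict_mod_mem_A)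
  have b: "b \<in> A_ideal p ls J"
    unfolding mem_A_ideal_iff[OF J] using bc
    by (auto simp: b_def intro!: dvd_mod_q level_le)
  define c where "c = b \<otimes>\<^bsub>A\<^esub> a"
  have cc: "c \<in> carrier A" using bc a by (simp add: c_def)
  have ci: "c i = (if ?l i dvd a i then ?l i mod ?q i else a i)" if "i < length ls" for i
    using that mod_q_mem[OF a that] by (auto simp: c_def mult_A b_def mod_simps)
  have KJ: "poset_ideal (P_part ls) (?K \<union> J)"
    by (intro poset_ideal_Un poset_ideal_elem_ideal_part J)
  have "a \<in> A_ideal p ls (?K \<union> J)" using a by (auto simp: A_ideal_def)
  moreover have "b \<in> A_ideal p ls (?K \<union> J)" using b A_ideal_mono[of J "?K \<union> J"] by blast
  ultimately have "c \<in> A_ideal p ls (?K \<union> J)"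
    unfolding c_def by (simp add: subgroup.m_closed[OF subgroup_A_ideal[OF KJ]])
  then have sub: "elem_ideal_part p ls c \<subseteq> ?K \<union> J" by (simp add: A_ideal_def)
  have Jsub: "J \<subseteq> elem_ideal_part p ls c"
  proof
    fix x assume x: "x \<in> J"
    obtain r k where rk: "x = (r, k)" by force
    have xP: "x \<in> P_part ls" using J x by (auto simp: poset_ideal_def)
    then obtain i where i: "i < length ls" "k = ls ! i" and rlt: "r < k"
      by (auto simp: rk P_part_def fund_poset_def in_set_conv_nth)
    have lev: "level J k \<le> r"
      using mem_ideal_iff_level_le[OF J _ rlt] x i by (simp add: rk)
    have "c i \<noteq> 0 \<and> multiplicity (int p) (c i) \<le> r"
    proof (cases "?l i dvd a i")
      case True
      \<comment> \<open>The strict inequality ensures that reduction modulo \<open>p ^ k\<close>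
        does not turn the new coordinate into 0.\<close>
      have "int p ^ level J k < int p ^ k"
        using lev rlt prime_gt_1_nat[OF prime_p] by (intro power_strict_increasing) auto
      then have "c i = int p ^ level J k" using ci[OF i(1)] True i by simp
      then show ?thesis using lev p_pos not_unit_p by (simp add: multiplicity_same_power)
    next
      case False
      \<comment> \<open>The untouched coordinate has multiplicity below the level, so its orbit
        already lies above \<open>x\<close>.\<close>
      then have "a i \<noteq> 0" by auto
      then have "\<not> level J k \<le> multiplicity (int p) (a i)"
        using False i power_dvd_iff_le_multiplicity[OF _ not_unit_p] by simp
      then show ?thesis using ci[OF i(1)] False lev \<open>a i \<noteq> 0\<close> by simp
    qed
    then have "c i \<noteq> 0" "fund_le x (multiplicity (int p) (c i), ls ! i)"
      using i rlt by (auto simp: rk fund_le_def)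
    then show "x \<in> elem_ideal_part p ls c"
      unfolding mem_elem_ideal_part_iff using xP i by blast
  qed
  have "?K \<subseteq> elem_ideal_part p ls c"
  proof
    fix x assume "x \<in> ?K"
    then obtain j where xP: "x \<in> P_part ls" and j: "j < length ls" "a j \<noteq> 0"
      and le: "fund_le x (multiplicity (int p) (a j), ls ! j)"
      unfolding mem_elem_ideal_part_iff by blast
    show "x \<in> elem_ideal_part p ls c"
    proof (cases "?l j dvd a j")
      case True
      \<comment> \<open>The overwritten coordinate contributed only elements of \<open>J\<close>,
        and \<open>Jsub\<close> recovers these.\<close>
      then have "(multiplicity (int p) (a j), ls ! j) \<in> J"
        using mem_ideal_iff_dvd[OF J a j] by simp
      then have "x \<in> J" using J le xP unfolding poset_ideal_def by blast
      then show ?thesis using Jsub by blast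
    next
      case False
      then show ?thesis unfolding mem_elem_ideal_part_iff using xP j le ci[OF j(1)] by auto
    qed
  qed
  then show ?thesis using b sub Jsub unfolding c_def by blast
qed

text \<open>Zero has the empty ideal, so translating it by a suitable element of
  \<open>A_ideal p ls I\<close> yields the ideal \<open>I\<close>.\<close>

lemma O_ideal_nonempty:
  assumes I: "poset_ideal (P_part ls) I"
  shows "O_ideal p ls I \<noteq> {}"
proof -
  interpret group A by (rule group_A)
  have "elem_ideal_part p ls \<one>\<^bsub>A\<^esub> = {}" by (auto simp: mem_elem_ideal_part_iff one_A)
  then obtain b where "b \<in> A_ideal p ls I" "elem_ideal_part p ls (b \<otimes>\<^bsub>A\<^esub> \<one>\<^bsub>A\<^esub>) = I"
    using translate_elem_ideal_part[OF I one_closed] by auto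
  then show ?thesis by (auto simp: A_ideal_def O_ideal_def)
qed

section \<open>Orbits of cosets in the subquotient\<close>

lemma carrier_subquotient:
  "carrier (subquotient p ls I J) = (\<lambda>a. A_ideal p ls J #>\<^bsub>A\<^esub> a) ` A_ideal p ls I"
  by (auto simp: subquotient_def FactGroup_def RCOSETS_def r_coset_def)

text \<open>An injective self-map of a finite set is onto.\<close>

lemma auto_image_A_ideal:
  assumes J: "poset_ideal (P_part ls) J" and g: "g \<in> auto A"
  shows "g ` A_ideal p ls J = A_ideal p ls J"
proof
  have Jc: "A_ideal p ls J \<subseteq> carrier A" by (auto simp: A_ideal_def)
  show "g ` A_ideal p ls J \<subseteq> A_ideal p ls J"
    using hom_mem_A_ideal[OF J] g by (auto simp: auto_def)
  then show "A_ideal p ls J \<subseteq> g ` A_ideal p ls J"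
    using endo_inj_surj[of "A_ideal p ls J" g] g Jc finite_subset[OF Jc finite_carrier_A]
    by (auto simp: auto_def Bij_def bij_betw_def intro: inj_on_subset)
qed

lemma auto_image_coset:
  assumes J: "poset_ideal (P_part ls) J" and g: "g \<in> auto A" and a: "a \<in> carrier A"
  shows "g ` (A_ideal p ls J #>\<^bsub>A\<^esub> a) = A_ideal p ls J #>\<^bsub>A\<^esub> g a"
proof -
  have "g (h \<otimes>\<^bsub>A\<^esub> a) = g h \<otimes>\<^bsub>A\<^esub> g a" if "h \<in> A_ideal p ls J" for h
    using that g a by (auto simp: auto_def hom_def A_ideal_def)
  then have "g ` (A_ideal p ls J #>\<^bsub>A\<^esub> a) = (g ` A_ideal p ls J) #>\<^bsub>A\<^esub> g a"
    unfolding r_coset_def image_UN by simp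
  then show ?thesis by (simp add: auto_image_A_ideal[OF J g])
qed

text \<open>Representatives of one coset may have different ideals, and all those in
  \<open>A_ideal p ls I\<close> describe the same orbit. This leaves the freedom to pick a
  representative with a convenient ideal.\<close>

lemma orbit_subquotient:
  assumes J: "poset_ideal (P_part ls) J" and a: "a \<in> A_ideal p ls I"
  shows "orbit (G_group p ls) (subquotient_action p ls I J) (A_ideal p ls J #>\<^bsub>A\<^esub> a)
    = (\<lambda>b. A_ideal p ls J #>\<^bsub>A\<^esub> b) ` O_ideal p ls (elem_ideal_part p ls a)"
proof -
  have ac: "a \<in> carrier A" using a by (auto simp: A_ideal_def)
  have "A_ideal p ls J #>\<^bsub>A\<^esub> a \<in> carrier (subquotient p ls I J)"
    using a by (auto simp: carrier_subquotient)
  then have "orbit (G_group p ls) (subquotient_action p ls I J) (A_ideal p ls J #>\<^bsub>A\<^esub> a)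
    = (\<lambda>g. A_ideal p ls J #>\<^bsub>A\<^esub> g a) ` auto A"
    using auto_image_coset[OF J _ ac]
    by (auto simp: orbit_def subquotient_action_def AutoGroup_def)
  then show ?thesis
    using auto_image_eq_O_ideal[OF poset_ideal_elem_ideal_part mem_O_ideal_elem_ideal_part[OF ac]]
    by (metis image_image)
qed

text \<open>Since \<open>A_ideal p ls J\<close> lies in \<open>A_ideal p ls I'\<close>, the latter
  is a union of cosets of the former, so membership can be tested on any representative.\<close>

lemma coset_in_subquotientD:
  assumes J: "poset_ideal (P_part ls) J" and I': "poset_ideal (P_part ls) I'" and "J \<subseteq> I'"
    and a: "a \<in> carrier A" and in': "A_ideal p ls J #>\<^bsub>A\<^esub> a \<in> carrier (subquotient p ls I' J)"
  shows "a \<in> A_ideal p ls I'"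
proof -
  interpret group A by (rule group_A)
  obtain b where b: "b \<in> A_ideal p ls I'" "A_ideal p ls J #>\<^bsub>A\<^esub> a = A_ideal p ls J #>\<^bsub>A\<^esub> b"
    using in' by (auto simp: carrier_subquotient)
  have "a \<in> A_ideal p ls J #>\<^bsub>A\<^esub> b"
    using rcos_self[OF a subgroup_A_ideal[OF J]] b(2) by simp
  then show ?thesis
    using b(1) A_ideal_mono[OF \<open>J \<subseteq> I'\<close>, of p ls]
      subgroup.m_closed[OF subgroup_A_ideal[OF I']]
    by (auto simp: r_coset_def)
qed

section \<open>The maximal orbit and the generic orbit\<close>

text \<open>The form as an equivalence yields existence and uniqueness together.\<close>

lemma maximal_orbit_iff:
  assumes I: "poset_ideal (P_part ls) I" and J: "poset_ideal (P_part ls) J" and JI: "J \<subseteq> I"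
  shows "maximal_orbit p ls I J T \<longleftrightarrow> T = O_image p ls I J"
proof
  interpret group A by (rule group_A)
  assume T: "maximal_orbit p ls I J T"
  then obtain a where a: "a \<in> A_ideal p ls I"
    and Ta: "T = orbit (G_group p ls) (subquotient_action p ls I J) (A_ideal p ls J #>\<^bsub>A\<^esub> a)"
    by (auto simp: maximal_orbit_def orbits_def carrier_subquotient)
  have ac: "a \<in> carrier A" using a by (auto simp: A_ideal_def)
  define K where "K = elem_ideal_part p ls a"
  have KJ: "poset_ideal (P_part ls) (K \<union> J)"
    unfolding K_def by (intro poset_ideal_Un poset_ideal_elem_ideal_part J)
  have "O_ideal p ls K \<subseteq> A_ideal p ls (K \<union> J)"
    using O_ideal_subset_A_ideal A_ideal_mono[of K "K \<union> J"] by blast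
  then have "T \<subseteq> carrier (subquotient p ls (K \<union> J) J)"
    using Ta orbit_subquotient[OF J a] by (auto simp: carrier_subquotient K_def)
  moreover have "K \<union> J \<subseteq> I" using a JI by (auto simp: A_ideal_def K_def)
  ultimately have KJI: "K \<union> J = I"
    using T KJ by (auto simp: maximal_orbit_def)
  \<comment> \<open>Passing from \<open>a\<close> to its translate by \<open>b\<close> keeps the
    coset and turns the ideal into \<open>I\<close>, so \<open>orbit_subquotient\<close> for the new
    representative gives \<open>O_image p ls I J\<close>.\<close>
  obtain b where b: "b \<in> A_ideal p ls J" "elem_ideal_part p ls (b \<otimes>\<^bsub>A\<^esub> a) = I"
    using translate_elem_ideal_part[OF J ac] KJI by (auto simp: K_def)
  have bc: "b \<in> carrier A" using b by (auto simp: A_ideal_def)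
  have "A_ideal p ls J #>\<^bsub>A\<^esub> a = A_ideal p ls J #>\<^bsub>A\<^esub> (b \<otimes>\<^bsub>A\<^esub> a)"
    by (rule repr_independence[OF _ ac subgroup_A_ideal[OF J]])
      (use b in \<open>auto simp: r_coset_def\<close>)
  moreover have "b \<otimes>\<^bsub>A\<^esub> a \<in> A_ideal p ls I" using b bc ac by (auto simp: A_ideal_def)
  ultimately show "T = O_image p ls I J"
    using Ta orbit_subquotient[OF J, of "b \<otimes>\<^bsub>A\<^esub> a" I] b(2) by (simp add: O_image_def)
next
  assume T: "T = O_image p ls I J"
  obtain a where a: "a \<in> O_ideal p ls I" using O_ideal_nonempty[OF I] by blast
  then have aI: "a \<in> A_ideal p ls I" "elem_ideal_part p ls a = I" "a \<in> carrier A"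
    using O_ideal_subset_A_ideal by (auto simp: O_ideal_def)
  have "T \<in> orbits (G_group p ls) (carrier (subquotient p ls I J)) (subquotient_action p ls I J)"
    using orbit_subquotient[OF J aI(1)] aI T
    by (auto simp: orbits_def carrier_subquotient O_image_def)
  moreover have "\<not> T \<subseteq> carrier (subquotient p ls I' J)"
    if I': "poset_ideal (P_part ls) I'" "J \<subseteq> I'" "I' \<subset> I" for I'
  proof
    assume "T \<subseteq> carrier (subquotient p ls I' J)"
    then have "A_ideal p ls J #>\<^bsub>A\<^esub> a \<in> carrier (subquotient p ls I' J)"
      using T a by (auto simp: O_image_def)
    then have "a \<in> A_ideal p ls I'" by (rule coset_in_subquotientD[OF J I'(1,2) aI(3)])
    then show False using aI(2) I'(3) by (auto simp: A_ideal_def)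
  qed
  ultimately show "maximal_orbit p ls I J T" by (auto simp: maximal_orbit_def)
qed

text \<open>If \<open>a\<close> lies in a generic orbit and has ideal \<open>K\<close>, the orbit
  meets \<open>A_ideal p ls K\<close> in \<open>a\<close>, so this subgroup is all of
  \<open>A\<close>. It then contains an element whose ideal is \<open>P_part ls\<close>, which
  forces \<open>K\<close> to be everything.\<close>

lemma generic_orbit_iff: "generic_orbit p ls T \<longleftrightarrow> T = O_ideal p ls (P_part ls)"
proof
  have P: "poset_ideal (P_part ls) (P_part ls)" by (auto simp: poset_ideal_def)
  have orb: "orbit (G_group p ls) (\<lambda>g. g) a = O_ideal p ls (elem_ideal_part p ls a)"
    if "a \<in> carrier A" for a
    using auto_image_eq_O_ideal[OF poset_ideal_elem_ideal_part mem_O_ideal_elem_ideal_part[OF that]]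
    by (auto simp: orbit_def AutoGroup_def)
  have all: "elem_ideal_part p ls a \<subseteq> P_part ls" for a by (auto simp: elem_ideal_part_def)
  obtain c where c: "c \<in> O_ideal p ls (P_part ls)" using O_ideal_nonempty[OF P] by blast
  show "T = O_ideal p ls (P_part ls)" if T: "generic_orbit p ls T"
  proof -
    obtain a where a: "a \<in> carrier A" and Ta: "T = O_ideal p ls (elem_ideal_part p ls a)"
      using T orb by (auto simp: generic_orbit_def orbits_def)
    have "a \<in> T \<inter> A_ideal p ls (elem_ideal_part p ls a)"
      using a Ta by (auto simp: O_ideal_def A_ideal_def)
    then have "\<not> A_ideal p ls (elem_ideal_part p ls a) \<subset> carrier A"
      using T poset_ideal_elem_ideal_part[of ls p a] unfolding generic_orbit_def by blast
    then have "c \<in> A_ideal p ls (elem_ideal_part p ls a)"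
      using c by (auto simp: A_ideal_def O_ideal_def)
    then have "elem_ideal_part p ls a = P_part ls"
      using c all[of a] by (auto simp: A_ideal_def O_ideal_def)
    then show ?thesis using Ta by simp
  qed
  show "generic_orbit p ls T" if T: "T = O_ideal p ls (P_part ls)"
    unfolding generic_orbit_def
  proof (intro conjI allI impI)
    show "T \<in> orbits (G_group p ls) (carrier A) (\<lambda>g. g)"
      using c orb[of c] T by (auto simp: orbits_def O_ideal_def)
    fix I assume "poset_ideal (P_part ls) I \<and> A_ideal p ls I \<subset> carrier A"
    \<comment> \<open>Properness of the subgroup shows that \<open>I\<close> is a proper ideal, so
      no element with ideal \<open>P_part ls\<close> can lie in it.\<close>
    then obtain x where "\<not> elem_ideal_part p ls x \<subseteq> I" by (auto simp: A_ideal_def)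
    then have "\<not> P_part ls \<subseteq> I" using all by blast
    then show "T \<inter> A_ideal p ls I = {}" using T by (auto simp: A_ideal_def O_ideal_def)
  qed
qed

end

theorem mainTheorem10:
  fixes p :: nat and ls :: "nat list"
  assumes "Factorial_Ring.prime p" and "is_partition ls"
  shows "(\<forall>I J. poset_ideal (P_part ls) I \<and> poset_ideal (P_part ls) J \<and> J \<subseteq> I \<longrightarrow>
            (\<exists>!T. maximal_orbit p ls I J T) \<and> maximal_orbit p ls I J (O_image p ls I J))
       \<and> (\<exists>!T. generic_orbit p ls T) \<and> generic_orbit p ls (O_ideal p ls (P_part ls))"
proof -
  interpret prime_type p ls using assms(1) by unfold_locales
  show ?thesis by (auto simp: maximal_orbit_iff generic_orbit_iff)
qed

end
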